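(* Let $n\ge1$. Each of the sets $A_n$ and $R_n$, listed in Co-Reflected Gray Code order $\prec_c$, is a $2$-adjacent Gray code: consecutive sequences differ in at most $2$ positions, and these positions are adjacent.
   Context: Statistics of $s_1\ldots s_k$: $\mathrm{asc}=\#\{i<k: s_i<s_{i+1}\}$, $\max=\max_i s_i$. $A_n$ (resp. $R_n$) is the set of sequences $s_1\ldots s_n$ of non-negative integers with $s_1=0$ and $0\le s_{k+1}\le \mathrm{asc}(s_1\ldots s_k)+1$ (resp. $\le\max(s_1\ldots s_k)+1$) for $1\le k<n$. Co-Reflected Gray Code order: $s\prec_c t$ if, with $k$ the rightmost position where $s$ and $t$ differ, either $\sum_{i=k+1}^n s_i+(n-k)$ is even and $s_k>t_k$, or it is odd and $s_k<t_k$. A $d$-adjacent Gray code is a list in which consecutive sequences have Hamming distance at most $d$ and the positions where they differ are adjacent. *)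

theory Defs
  imports Main
begin

text \<open>A sequence \<open>s\<^sub>1 \<dots> s\<^sub>n\<close> of non-negative integers is a list \<open>s\<close> of length \<open>n\<close>; positions
  are shifted by one, so \<open>s\<^sub>k\<^sub>+\<^sub>1\<close> is \<open>s ! k\<close> and the prefix \<open>s\<^sub>1 \<dots> s\<^sub>k\<close> is \<open>take k s\<close>.\<close>

definition asc :: "nat list \<Rightarrow> nat" where
  "asc s = card {i. Suc i < length s \<and> s ! i < s ! Suc i}"

definition ascent_sequences :: "nat \<Rightarrow> nat list set" where
  "ascent_sequences n = {s. length s = n \<and> s ! 0 = 0 \<and>
     (\<forall>k. 1 \<le> k \<and> k < n \<longrightarrow> s ! k \<le> asc (take k s) + 1)}"

definition restricted_growth_functions :: "nat \<Rightarrow> nat list set" where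
  "restricted_growth_functions n = {s. length s = n \<and> s ! 0 = 0 \<and>
     (\<forall>k. 1 \<le> k \<and> k < n \<longrightarrow> s ! k \<le> Max (set (take k s)) + 1)}"

definition diff_positions :: "nat list \<Rightarrow> nat list \<Rightarrow> nat set" where
  "diff_positions s t = {i. i < length s \<and> s ! i \<noteq> t ! i}"

definition hamming_dist :: "nat list \<Rightarrow> nat list \<Rightarrow> nat" where
  "hamming_dist s t = card (diff_positions s t)"

text \<open>Because of the index shift, the number \<open>n - k\<close> of entries to the right of the
  rightmost difference is \<open>length s - Suc k\<close>.\<close>

definition co_reflected_less :: "nat list \<Rightarrow> nat list \<Rightarrow> bool"  (infix "\<prec>\<^sub>c" 50) where
  "s \<prec>\<^sub>c t \<longleftrightarrow> length s = length t \<and>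
     (\<exists>k < length s. s ! k \<noteq> t ! k \<and> (\<forall>i. k < i \<and> i < length s \<longrightarrow> s ! i = t ! i) \<and>
        (let p = (\<Sum>i = Suc k..<length s. s ! i) + (length s - Suc k)
         in (even p \<and> s ! k > t ! k) \<or> (odd p \<and> s ! k < t ! k)))"

definition lists_in_order :: "('a \<Rightarrow> 'a \<Rightarrow> bool) \<Rightarrow> 'a set \<Rightarrow> 'a list \<Rightarrow> bool" where
  "lists_in_order r S L \<longleftrightarrow> distinct L \<and> set L = S \<and> sorted_wrt r L"

text \<open>Positions are adjacent when they form a block of consecutive indices; for two positions
  this says that they are \<open>i\<close> and \<open>i + 1\<close>.\<close>

definition adjacent_gray_code :: "nat \<Rightarrow> nat list list \<Rightarrow> bool" where
  "adjacent_gray_code d L \<longleftrightarrow>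
     (\<forall>j. Suc j < length L \<longrightarrow>
        length (L ! j) = length (L ! Suc j) \<and>
        hamming_dist (L ! j) (L ! Suc j) \<le> d \<and>
        (\<exists>a b. diff_positions (L ! j) (L ! Suc j) = {a..<b}))"

end

theory Submission
  imports Defs
begin

text \<open>Fix a suffix \<open>w\<close> and look at the block of all sequences ending in \<open>w\<close>. Among the admissible
  prefixes of a given length, the staircase \<open>0 1 \<dots> j\<close> dominates all others, and the prefix
  \<open>0 1 \<dots> (j-1) 0\<close> dominates all those that are not the staircase. Hence the first and the last
  element of the block have the form \<open>0 1 \<dots> (j-1) x w\<close>: if the largest entry \<open>x\<close> is required, it
  is \<open>j\<close> and forces the staircase; if the smallest one is required, it is either \<open>j\<close> again or \<open>0\<close>,
  and in the latter case the parity changes, so that the next entry to the left has to be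
  largest. Two consecutive sequences with rightmost difference \<open>k\<close> are the last and the first
  element of the blocks of their suffixes starting at \<open>k\<close>, so they agree left of \<open>k - 1\<close>.\<close>

section \<open>Listing a finite set along a strict total order\<close>

text \<open>By induction, a new element \<open>a\<close> goes after the elements below it and before
  all others. Totality puts \<open>a\<close> below the latter, and transitivity through
  \<open>a\<close> relates the two groups.\<close>

lemma ex_lists_in_order:
  assumes "finite S" "transp_on S r" "totalp_on S r"
  shows "\<exists>L. lists_in_order r S L"
  using assms
proof (induction S rule: finite_induct)
  case empty
  show ?case by (auto simp: lists_in_order_def)
next
  case (insert a S)
  have "transp_on S r" "totalp_on S r"
    using insert.prems by (auto intro: transp_on_subset totalp_on_subset)
  then obtain L where L: "distinct L" "set L = S" "sorted_wrt r L"
    using insert.IH by (auto simp: lists_in_order_def)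
  have trans: "r x z" if "r x y" "r y z" "x \<in> insert a S" "y \<in> insert a S" "z \<in> insert a S" for x y z
    using transp_onD[OF insert.prems(1) that(3-5,1,2)] .
  have total: "r x a \<or> r a x" if "x \<in> S" for x
    using totalp_onD[OF insert.prems(2), of x a] insert.hyps(2) that by auto
  let ?L = "filter (\<lambda>x. r x a) L @ a # filter (\<lambda>x. \<not> r x a) L"
  have "sorted_wrt r ?L"
    unfolding sorted_wrt_append sorted_wrt.simps
  proof (intro conjI ballI)
    fix x y assume x: "x \<in> set (filter (\<lambda>x. r x a) L)"
      and y: "y \<in> set (a # filter (\<lambda>x. \<not> r x a) L)"
    then show "r x y" using L(2) total[of y] trans[of x a y] by auto
  qed (use L total in \<open>auto intro: sorted_wrt_filter\<close>)
  moreover have "distinct ?L" "set ?L = insert a S"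
    using L insert.hyps(2) by auto
  ultimately show ?case unfolding lists_in_order_def by blast
qed

text \<open>Two distinct heads would precede each other, against asymmetry. Removing the common head
  leaves two listings of the same smaller set.\<close>

lemma lists_in_order_unique:
  assumes "asymp_on S r" "lists_in_order r S L" "lists_in_order r S M"
  shows "L = M"
  using assms
proof (induction L arbitrary: M S)
  case Nil
  then show ?case by (auto simp: lists_in_order_def)
next
  case (Cons a L)
  then obtain b M' where M: "M = b # M'"
    by (cases M) (auto simp: lists_in_order_def)
  have S: "S = insert a (set L)" "S = insert b (set M')"
    and ra: "\<forall>x\<in>set L. r a x" and rb: "\<forall>x\<in>set M'. r b x"
    and nin: "a \<notin> set L" "b \<notin> set M'"
    using Cons.prems unfolding M lists_in_order_def by auto
  have "a = b"
  proof (rule ccontr)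
    assume "a \<noteq> b"
    moreover have "b \<in> insert a (set L)" "a \<in> insert b (set M')" using S by blast+
    ultimately have "r a b" "r b a" using ra rb by auto
    moreover have "a \<in> S" "b \<in> S" using S by auto
    ultimately show False using Cons.prems(1) by (meson asymp_onD)
  qed
  moreover have "set M' = set L" using S nin \<open>a = b\<close> by auto
  moreover have "asymp_on (set L) r"
    using Cons.prems(1) S(1) by (meson asymp_on_subset subset_insertI)
  ultimately show ?case
    using Cons.prems(2,3) Cons.IH[of "set L" M'] unfolding M lists_in_order_def by auto
qed

text \<open>Every \<open>x\<close> in \<open>S\<close> has an index in \<open>L\<close>, and none
  lies strictly between \<open>j\<close> and \<open>Suc j\<close>. This supplies the hypothesis
  \<open>consec\<close> of \<open>consecutive_adjacent\<close>.\<close>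

lemma lists_in_order_consecutive:
  assumes "asymp_on S r" "lists_in_order r S L" "Suc j < length L" "x \<in> S" "r (L ! j) x"
  shows "\<not> r x (L ! Suc j)"
proof
  assume less: "r x (L ! Suc j)"
  have S: "set L = S" and sorted: "sorted_wrt r L" using assms(2) by (auto simp: lists_in_order_def)
  obtain m where m: "m < length L" "x = L ! m"
    using assms(4) S by (metis in_set_conv_nth)
  have asym: "\<not> r z y" if "r y z" "y \<in> S" "z \<in> S" for y z
    using assms(1) that by (meson asymp_onD)
  have mem: "L ! i \<in> S" if "i < length L" for i using that S by auto
  have irrefl: "\<not> r y y" if "y \<in> S" for y using asym that by blast
  consider "m < j" | "m = j" | "m = Suc j" | "Suc j < m" by linarith
  then show False
  proof cases
    case 1
    then have "r x (L ! j)" using sorted assms(3) m by (simp add: sorted_wrt_iff_nth_less)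
    then show False using asym assms(3,4,5) mem by (meson Suc_lessD)
  next
    case 4
    then have "r (L ! Suc j) x" using sorted assms(3) m by (simp add: sorted_wrt_iff_nth_less)
    then show False using asym assms(3,4) less mem by meson
  qed (use irrefl assms(4,5) less m in auto)
qed

section \<open>The Co-Reflected Gray Code order\<close>

text \<open>True is the even case of the order, in which larger entries at position \<open>k\<close>
  come first.\<close>

definition tail_parity :: "nat list \<Rightarrow> nat \<Rightarrow> bool" where
  "tail_parity s k \<longleftrightarrow> even ((\<Sum>i = Suc k..<length s. s ! i) + (length s - Suc k))"

definition agree_after :: "nat \<Rightarrow> nat list \<Rightarrow> nat list \<Rightarrow> bool" where
  "agree_after k s t \<longleftrightarrow> length s = length t \<and> (\<forall>i. k < i \<and> i < length s \<longrightarrow> s ! i = t ! i)"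

lemma agree_after_sym: "agree_after k s t \<Longrightarrow> agree_after k t s"
  by (auto simp: agree_after_def)

lemma tail_parity_cong: "agree_after k s t \<Longrightarrow> tail_parity s k = tail_parity t k"
  unfolding tail_parity_def agree_after_def by simp

text \<open>Passing one position to the left adds the entry \<open>s ! Suc k\<close> and one unit of
  length, so the parity flips exactly when that entry is even. The case used later is the entry
  0.\<close>

lemma tail_parity_Suc:
  assumes "Suc k < length s"
  shows "tail_parity s k \<longleftrightarrow> (even (s ! Suc k) \<longleftrightarrow> \<not> tail_parity s (Suc k))"
proof -
  have "(\<Sum>i = Suc k..<length s. s ! i) = s ! Suc k + (\<Sum>i = Suc (Suc k)..<length s. s ! i)"
    using assms by (rule sum.atLeast_Suc_lessThan)
  moreover have "length s - Suc k = Suc (length s - Suc (Suc k))" using assms by simp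
  ultimately show ?thesis unfolding tail_parity_def by auto
qed

lemma co_reflected_less_iff:
  "s \<prec>\<^sub>c t \<longleftrightarrow> (\<exists>k < length s. agree_after k s t \<and>
     (if tail_parity s k then s ! k > t ! k else s ! k < t ! k))"
proof -
  have *: "x \<noteq> y \<and> Q \<and> (P \<and> y < x \<or> \<not> P \<and> x < y) \<longleftrightarrow> Q \<and> (if P then y < x else x < y)"
    for x y :: nat and P Q by auto
  show ?thesis
    unfolding co_reflected_less_def agree_after_def tail_parity_def Let_def * by blast
qed

text \<open>The rightmost difference is unique, so only the given \<open>k\<close> can witness the
  existential quantifier in the order.\<close>

lemma co_reflected_less_at:
  assumes "agree_after k s t" "k < length s" "s ! k \<noteq> t ! k"
  shows "s \<prec>\<^sub>c t \<longleftrightarrow> (if tail_parity s k then s ! k > t ! k else s ! k < t ! k)"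
proof -
  have "k' = k" if "k' < length s" "agree_after k' s t" "s ! k' \<noteq> t ! k'" for k'
    using assms that unfolding agree_after_def by (metis linorder_neqE_nat)
  then show ?thesis
    unfolding co_reflected_less_iff using assms by (metis less_irrefl)
qed

lemma obtain_rightmost_difference:
  assumes "length s = length t" "s \<noteq> t"
  obtains k where "k < length s" "agree_after k s t" "s ! k \<noteq> t ! k"
proof -
  let ?D = "{k. k < length s \<and> s ! k \<noteq> t ! k}"
  have fin: "finite ?D" by simp
  have "?D \<noteq> {}" using assms by (auto simp: list_eq_iff_nth_eq)
  then have "Max ?D \<in> ?D" using fin Max_in by blast
  moreover have "i \<notin> ?D" if "Max ?D < i" for i using Max_ge[OF fin] that by (meson not_le)
  ultimately have "Max ?D < length s" "agree_after (Max ?D) s t" "s ! Max ?D \<noteq> t ! Max ?D"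
    using assms(1) unfolding agree_after_def by blast+
  then show thesis by (rule that)
qed

lemma co_reflected_less_asym: "s \<prec>\<^sub>c t \<Longrightarrow> \<not> t \<prec>\<^sub>c s"
proof
  assume "s \<prec>\<^sub>c t" "t \<prec>\<^sub>c s"
  from \<open>s \<prec>\<^sub>c t\<close> obtain k where k: "k < length s" "agree_after k s t"
    "if tail_parity s k then s ! k > t ! k else s ! k < t ! k"
    unfolding co_reflected_less_iff by blast
  have "length s = length t" using k(2) by (simp add: agree_after_def)
  moreover have "t ! k \<noteq> s ! k" using k(3) by (auto split: if_splits)
  ultimately show False
    using \<open>t \<prec>\<^sub>c s\<close> k co_reflected_less_at[OF agree_after_sym[OF k(2)]] tail_parity_cong[OF k(2)]
    by (auto split: if_splits)
qed

text \<open>The rightmost difference of \<open>s\<close> and \<open>u\<close> is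
  \<open>max k l\<close>. The larger of \<open>k\<close> and \<open>l\<close> decides alone; if they
  coincide, both comparisons use the same parity and hence the same direction.\<close>

lemma co_reflected_less_trans:
  assumes "s \<prec>\<^sub>c t" "t \<prec>\<^sub>c u"
  shows "s \<prec>\<^sub>c u"
proof -
  obtain k where k: "k < length s" "agree_after k s t"
    "if tail_parity s k then s ! k > t ! k else s ! k < t ! k"
    using assms(1) unfolding co_reflected_less_iff by blast
  obtain l where l: "l < length t" "agree_after l t u"
    "if tail_parity t l then t ! l > u ! l else t ! l < u ! l"
    using assms(2) unfolding co_reflected_less_iff by blast
  have len: "length s = length t" "length t = length u"
    using k(2) l(2) by (auto simp: agree_after_def)
  have agree: "agree_after (max k l) s u" using k(2) l(2) by (auto simp: agree_after_def)
  have "if tail_parity s (max k l) then s ! max k l > u ! max k l else s ! max k l < u ! max k l"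
  proof (cases k l rule: linorder_cases)
    case less
    then have "agree_after l s t" "s ! l = t ! l" using k(2) l(1) len by (auto simp: agree_after_def)
    then show ?thesis using l(3) less tail_parity_cong by (auto simp: max_def)
  next
    case equal
    then show ?thesis using k l tail_parity_cong[OF k(2)] by (auto split: if_splits)
  next
    case greater
    then have "t ! k = u ! k" using l(2) k(1) len by (auto simp: agree_after_def)
    then show ?thesis using k(3) greater by (auto simp: max_def)
  qed
  then show ?thesis
    unfolding co_reflected_less_iff using agree k(1) l(1) len by (intro exI[of _ "max k l"]) simp
qed

lemma co_reflected_less_total:
  assumes "length s = length t" "s \<noteq> t"
  shows "s \<prec>\<^sub>c t \<or> t \<prec>\<^sub>c s"
proof -
  obtain k where k: "k < length s" "agree_after k s t" "s ! k \<noteq> t ! k"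
    using obtain_rightmost_difference[OF assms] .
  then show ?thesis
    using co_reflected_less_at[OF k(2)] co_reflected_less_at[OF agree_after_sym[OF k(2)]]
      tail_parity_cong[OF k(2)] assms(1) by auto
qed

section \<open>Sequences with growth bounded by a statistic\<close>

text \<open>Common form of the two sets: \<open>f\<close> is \<open>asc\<close> for ascent sequences
  and the maximum for restricted growth functions.\<close>

definition growth_sequences :: "(nat list \<Rightarrow> nat) \<Rightarrow> nat \<Rightarrow> nat list set" where
  "growth_sequences f n = {s. length s = n \<and> s ! 0 = 0 \<and>
     (\<forall>k. 1 \<le> k \<and> k < n \<longrightarrow> s ! k \<le> f (take k s) + 1)}"

lemma take_growth_sequences:
  "s \<in> growth_sequences f n \<Longrightarrow> 1 \<le> m \<Longrightarrow> m \<le> n \<Longrightarrow> take m s \<in> growth_sequences f m"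
  by (auto simp: growth_sequences_def min_def)

lemma nth_staircase_prefix:
  assumes "take (Suc k) s = [0..<Suc k]" "i \<le> k"
  shows "s ! i = i"
proof -
  have "take (Suc k) s ! i = [0..<Suc k] ! i" using assms(1) by simp
  then show ?thesis using assms(2) by (simp del: upt_Suc)
qed

text \<open>The continuation \<open>u\<close> is arbitrary because an exchanged prefix must keep the
  bounds of all later entries. The condition \<open>x ! k < k\<close> singles out the prefixes other
  than the staircase.\<close>

locale growth_statistic =
  fixes f :: "nat list \<Rightarrow> nat"
  assumes staircase_value: "f [0..<Suc k] = k"
    and staircase_unique: "x \<in> growth_sequences f (Suc k) \<Longrightarrow> k \<le> f x \<Longrightarrow> x = [0..<Suc k]"
    and staircase_dominates: "x \<in> growth_sequences f (Suc k) \<Longrightarrow> f (x @ u) \<le> f ([0..<Suc k] @ u)"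
    and staircase_zero_dominates: "x \<in> growth_sequences f (Suc k) \<Longrightarrow> x ! k < k \<Longrightarrow>
      f (x @ u) \<le> f ([0..<k] @ 0 # u)"
begin

text \<open>For \<open>k = Suc j\<close>, such an entry requires a value of at least
  \<open>j\<close> on the preceding prefix, which only the staircase attains; the growth bound then
  makes the entry exactly \<open>k\<close>.\<close>

lemma staircase_entry:
  assumes "s \<in> growth_sequences f n" "k < n" "k \<le> s ! k"
  shows "take (Suc k) s = [0..<Suc k]"
proof (cases k)
  case 0
  moreover have "s \<noteq> []" "s ! 0 = 0" using assms by (auto simp: growth_sequences_def)
  ultimately show ?thesis by (simp add: take_Suc_conv_app_nth)
next
  case (Suc j)
  have bound: "s ! k \<le> f (take k s) + 1"
    using assms(1,2) Suc by (simp add: growth_sequences_def)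
  then have "j \<le> f (take k s)" using assms(3) Suc by simp
  moreover have "take k s \<in> growth_sequences f (Suc j)"
    using take_growth_sequences[OF assms(1), of k] assms(2) Suc by simp
  ultimately have *: "take k s = [0..<Suc j]"
    by (intro staircase_unique)
  then have "s ! k = k" using bound assms(3) Suc staircase_value[of j] by simp
  moreover have "length s = n" using assms(1) by (simp add: growth_sequences_def)
  ultimately show ?thesis
    using assms(2) * Suc by (simp add: take_Suc_conv_app_nth)
qed

lemma entry_le:
  assumes "s \<in> growth_sequences f n" "k < n"
  shows "s ! k \<le> k"
proof (rule ccontr)
  assume "\<not> s ! k \<le> k"
  then have "take (Suc k) s = [0..<Suc k]" using staircase_entry[OF assms] by simp
  then have "s ! k = k" by (rule nth_staircase_prefix) simp
  then show False using \<open>\<not> s ! k \<le> k\<close> by simp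
qed

lemma finite_growth_sequences: "finite (growth_sequences f n)"
proof (rule finite_subset)
  show "growth_sequences f n \<subseteq> {s. set s \<subseteq> {..n} \<and> length s = n}"
  proof
    fix s assume s: "s \<in> growth_sequences f n"
    then have "length s = n" by (simp add: growth_sequences_def)
    then show "s \<in> {s. set s \<subseteq> {..n} \<and> length s = n}"
      using entry_le[OF s] by (force simp: in_set_conv_nth)
  qed
  show "finite {s. set s \<subseteq> {..n} \<and> length s = n}" by (rule finite_lists_length_eq) simp
qed

lemma staircase_growth: "[0..<Suc k] \<in> growth_sequences f (Suc k)"
proof -
  have "i \<le> f [0..<i] + 1" if "1 \<le> i" for i
    using staircase_value[of "i - 1"] that by auto
  then show ?thesis by (auto simp: growth_sequences_def take_upt nth_append simp del: upt_Suc)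
qed

lemma staircase_zero_growth:
  assumes "0 < k"
  shows "[0..<k] @ [0] \<in> growth_sequences f (Suc k)"
proof -
  have "[0..<k] \<in> growth_sequences f k" using staircase_growth[of "k - 1"] assms by simp
  then show ?thesis using assms by (auto simp: growth_sequences_def nth_append)
qed

text \<open>Entries inside the new prefix obey the bound because \<open>x\<close> does; later
  entries are unchanged, and by \<open>dom\<close> their bounds do not decrease.\<close>

lemma replace_prefix:
  assumes s: "s \<in> growth_sequences f n" and k: "k < n"
    and x: "x \<in> growth_sequences f (Suc k)"
    and dom: "\<And>u. f (take (Suc k) s @ u) \<le> f (x @ u)"
  shows "x @ drop (Suc k) s \<in> growth_sequences f n"
proof -
  let ?t = "x @ drop (Suc k) s"
  have len: "length s = n" "length x = Suc k" using s x by (auto simp: growth_sequences_def)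
  have "?t ! i \<le> f (take i ?t) + 1" if i: "1 \<le> i" "i < n" for i
  proof (cases "i \<le> k")
    case True
    then show ?thesis using x i len by (auto simp: growth_sequences_def nth_append)
  next
    case False
    have "take i s = take (Suc k) s @ take (i - Suc k) (drop (Suc k) s)"
      using False by (metis le_add_diff_inverse not_less_eq_eq take_add)
    then have "f (take i s) \<le> f (take i ?t)" using dom len False by simp
    moreover have "s ! i \<le> f (take i s) + 1" using s i by (simp add: growth_sequences_def)
    moreover have "?t ! i = s ! i" using False len i by (simp add: nth_append)
    ultimately show ?thesis by simp
  qed
  moreover have "?t ! 0 = 0" using x len by (simp add: growth_sequences_def nth_append)
  ultimately show ?thesis using len k by (simp add: growth_sequences_def)
qed

lemma staircase_prefix:
  assumes "s \<in> growth_sequences f n" "k < n"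
  shows "[0..<Suc k] @ drop (Suc k) s \<in> growth_sequences f n"
  using assms by (intro replace_prefix staircase_growth staircase_dominates take_growth_sequences) auto

lemma staircase_zero_prefix:
  assumes "s \<in> growth_sequences f n" "k < n" "s ! k < k"
  shows "[0..<k] @ 0 # drop (Suc k) s \<in> growth_sequences f n"
proof -
  have "f (take (Suc k) s @ u) \<le> f (([0..<k] @ [0]) @ u)" for u
    using staircase_zero_dominates[of "take (Suc k) s" k u] take_growth_sequences[OF assms(1)] assms
    by auto
  from replace_prefix[OF assms(1,2) staircase_zero_growth this] assms(3)
  show ?thesis by auto
qed

section \<open>Extreme elements of blocks and consecutive sequences\<close>

text \<open>The flag \<open>b\<close> distinguishes the last (true) from the first (false) element of the block of
  sequences that coincide with \<open>s\<close> from position \<open>k\<close> on.\<close>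

lemma block_extreme:
  assumes s: "s \<in> growth_sequences f n" and k: "k < n"
    and extreme: "\<And>j x. x \<in> growth_sequences f n \<Longrightarrow> j < k \<Longrightarrow> agree_after j s x \<Longrightarrow>
      if tail_parity s j = b then s ! j \<le> x ! j else x ! j \<le> s ! j"
    and i: "Suc i < k"
  shows "s ! i = i"
proof -
  have len: "length s = n" using s by (simp add: growth_sequences_def)
  have top: "s ! i' = i'" if "j < k" "j \<le> s ! j" "i' \<le> j" for i' j
  proof -
    have "take (Suc j) s = [0..<Suc j]" using staircase_entry[OF s] that k by simp
    then show ?thesis using that(3) by (rule nth_staircase_prefix)
  qed
  \<comment> \<open>The staircase exchange puts \<open>j\<close> at position \<open>j\<close> and
    keeps everything to its right. Where the extreme element must have the largest entry,
    \<open>s ! j\<close> is therefore at least \<open>j\<close>.\<close>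
  have large: "j \<le> s ! j" if "j < k" "tail_parity s j \<noteq> b" for j
  proof -
    have "agree_after j s ([0..<Suc j] @ drop (Suc j) s)"
      using that k len by (auto simp: agree_after_def nth_append simp del: upt_Suc)
    from extreme[OF staircase_prefix[OF s] that(1) this] that k
    show ?thesis by (simp add: nth_append del: upt_Suc)
  qed
  define j where "j = k - 1"
  have j: "j < k" "i < j" using i by (auto simp: j_def)
  show ?thesis
  proof (cases "j \<le> s ! j")
    case True
    then show ?thesis using top j by simp
  next
    case False
    then have b: "tail_parity s j = b" using large j by blast
    \<comment> \<open>Since \<open>s ! j < j\<close>, the exchange with final 0 is admissible, and
      minimality of \<open>s ! j\<close> leaves only 0.\<close>
    have "agree_after j s ([0..<j] @ 0 # drop (Suc j) s)"
      using j k len by (auto simp: agree_after_def nth_append nth_Cons')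
    from extreme[OF staircase_zero_prefix[OF s] j(1) this] False j k b
    have "s ! j = 0" by (simp add: nth_append)
    \<comment> \<open>The entry 0 is even, so the parity at \<open>j - 1\<close> is opposite to that
      at \<open>j\<close>. The entry there has to be largest and forces the staircase up to
      \<open>j - 1\<close>, which still covers \<open>i\<close>.\<close>
    then have "tail_parity s (j - 1) \<noteq> b"
      using b tail_parity_Suc[of "j - 1" s] j k len by auto
    then show ?thesis using large[of "j - 1"] top[of "j - 1" i] j by auto
  qed
qed

theorem consecutive_adjacent:
  assumes s: "s \<in> growth_sequences f n" and t: "t \<in> growth_sequences f n" and less: "s \<prec>\<^sub>c t"
    and consec: "\<And>x. x \<in> growth_sequences f n \<Longrightarrow> s \<prec>\<^sub>c x \<Longrightarrow> \<not> x \<prec>\<^sub>c t"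
  shows "hamming_dist s t \<le> 2 \<and> (\<exists>a b. diff_positions s t = {a..<b})"
proof -
  have len: "length s = n" "length t = n" using s t by (auto simp: growth_sequences_def)
  obtain k where k: "k < n" "agree_after k s t"
    "if tail_parity s k then s ! k > t ! k else s ! k < t ! k"
    using less len unfolding co_reflected_less_iff by blast
  have ne: "s ! k \<noteq> t ! k" using k(3) by (auto split: if_splits)
  have s_stair: "s ! i = i" if "Suc i < k" for i
  proof (rule block_extreme[OF s k(1) _ that, where b = True])
    fix j x assume x: "x \<in> growth_sequences f n" "j < k" "agree_after j s x"
    have "agree_after k x t" "x ! k = s ! k" "agree_after k s x"
      using x k len by (auto simp: agree_after_def)
    \<comment> \<open>Changes left of \<open>k\<close> do not affect the comparison with
      \<open>t\<close>, so \<open>x\<close> precedes \<open>t\<close> as \<open>s\<close> does and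
      cannot follow \<open>s\<close>.\<close>
    then have "x \<prec>\<^sub>c t"
      using less ne k len co_reflected_less_at[of k x t] tail_parity_cong[of k s x]
      by (auto simp: agree_after_def)
    then have "\<not> s \<prec>\<^sub>c x" using consec x(1) by blast
    then show "if tail_parity s j = True then s ! j \<le> x ! j else x ! j \<le> s ! j"
      using co_reflected_less_at[OF x(3)] x(2) k(1) len by (cases "s ! j = x ! j") auto
  qed
  have t_stair: "t ! i = i" if "Suc i < k" for i
  proof (rule block_extreme[OF t k(1) _ that, where b = False])
    fix j x assume x: "x \<in> growth_sequences f n" "j < k" "agree_after j t x"
    have "agree_after k s x" "x ! k = t ! k"
      using x k len by (auto simp: agree_after_def)
    \<comment> \<open>Dually, \<open>x\<close> shares its suffix with \<open>t\<close>, so it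
      follows \<open>s\<close> and cannot precede \<open>t\<close>.\<close>
    then have "s \<prec>\<^sub>c x"
      using less ne k len co_reflected_less_at[of k s x] by auto
    then have "\<not> x \<prec>\<^sub>c t" using consec x(1) by blast
    moreover have "length x = n" using x(1) by (simp add: growth_sequences_def)
    ultimately show "if tail_parity t j = False then t ! j \<le> x ! j else x ! j \<le> t ! j"
      using co_reflected_less_at[OF agree_after_sym[OF x(3)]] tail_parity_cong[OF x(3)] x(2) k(1)
      by (cases "t ! j = x ! j") auto
  qed
  have sub: "i = k \<or> Suc i = k" if "i \<in> diff_positions s t" for i
  proof -
    have "\<not> Suc i < k" using that s_stair[of i] t_stair[of i] by (auto simp: diff_positions_def)
    moreover have "\<not> k < i" using that k(2) by (auto simp: diff_positions_def agree_after_def)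
    ultimately show ?thesis by linarith
  qed
  have kin: "k \<in> diff_positions s t" using ne k(1) len by (auto simp: diff_positions_def)
  \<comment> \<open>The interval ends at \<open>k\<close> and starts at \<open>k\<close> or
    \<open>k - 1\<close>; the conjunct \<open>k \<le> Suc a\<close> records that its size is at most
    2.\<close>
  have "\<exists>a. k \<le> Suc a \<and> diff_positions s t = {a..<Suc k}"
  proof (cases "0 < k \<and> k - 1 \<in> diff_positions s t")
    case True
    have "diff_positions s t = {k - 1..<Suc k}"
    proof
      show "diff_positions s t \<subseteq> {k - 1..<Suc k}" using sub by force
      show "{k - 1..<Suc k} \<subseteq> diff_positions s t"
      proof
        fix i assume "i \<in> {k - 1..<Suc k}"
        then have "i = k \<or> i = k - 1" by auto
        then show "i \<in> diff_positions s t" using True kin by blast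
      qed
    qed
    then show ?thesis using True by (intro exI[of _ "k - 1"]) auto
  next
    case False
    then have "diff_positions s t = {k..<Suc k}" using sub kin by force
    then show ?thesis by (intro exI[of _ k]) simp
  qed
  then obtain a where a: "k \<le> Suc a" "diff_positions s t = {a..<Suc k}" by blast
  then have "hamming_dist s t \<le> 2" by (simp add: hamming_dist_def)
  then show ?thesis using a(2) by blast
qed

text \<open>A strict total order on a finite set has exactly one listing, so the second conjunct
  speaks of that listing and is not vacuous.\<close>

theorem growth_sequences_gray_code:
  "(\<exists>!L. lists_in_order (\<prec>\<^sub>c) (growth_sequences f n) L) \<and>
    (\<forall>L. lists_in_order (\<prec>\<^sub>c) (growth_sequences f n) L \<longrightarrow> adjacent_gray_code 2 L)"
proof -
  let ?S = "growth_sequences f n"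
  have len: "length s = n" if "s \<in> ?S" for s using that by (simp add: growth_sequences_def)
  have asym: "asymp_on ?S (\<prec>\<^sub>c)" by (rule asymp_onI) (rule co_reflected_less_asym)
  have "transp_on ?S (\<prec>\<^sub>c)" by (rule transp_onI) (rule co_reflected_less_trans)
  moreover have "totalp_on ?S (\<prec>\<^sub>c)"
    by (rule totalp_onI) (simp add: co_reflected_less_total len)
  ultimately have "\<exists>!L. lists_in_order (\<prec>\<^sub>c) ?S L"
    using ex_lists_in_order[OF finite_growth_sequences] lists_in_order_unique[OF asym]
    by (intro ex_ex1I) blast+
  moreover have "adjacent_gray_code 2 L" if L: "lists_in_order (\<prec>\<^sub>c) ?S L" for L
    unfolding adjacent_gray_code_def
  proof (intro allI impI)
    fix j assume j: "Suc j < length L"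
    have mem: "L ! j \<in> ?S" "L ! Suc j \<in> ?S"
      using L j nth_mem[of j L] nth_mem[of "Suc j" L] by (simp_all add: lists_in_order_def)
    have "L ! j \<prec>\<^sub>c L ! Suc j"
      using L j by (auto simp: lists_in_order_def sorted_wrt_iff_nth_less)
    then have "hamming_dist (L ! j) (L ! Suc j) \<le> 2 \<and>
        (\<exists>a b. diff_positions (L ! j) (L ! Suc j) = {a..<b})"
      using lists_in_order_consecutive[OF asym L j] by (rule consecutive_adjacent[OF mem])
    then show "length (L ! j) = length (L ! Suc j) \<and> hamming_dist (L ! j) (L ! Suc j) \<le> 2 \<and>
        (\<exists>a b. diff_positions (L ! j) (L ! Suc j) = {a..<b})"
      using len mem by simp
  qed
  ultimately show ?thesis by blast
qed

end

section \<open>The two statistics\<close>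

lemma asc_singleton: "asc [a] = 0"
  by (simp add: asc_def)

lemma asc_Cons_Cons: "asc (a # b # xs) = (if a < b then 1 else 0) + asc (b # xs)"
proof -
  let ?A = "{i. Suc i < length (b # xs) \<and> (b # xs) ! i < (b # xs) ! Suc i}"
  have "{i. Suc i < length (a # b # xs) \<and> (a # b # xs) ! i < (a # b # xs) ! Suc i}
      = (if a < b then {0} else {}) \<union> Suc ` ?A" (is "?B = ?C")
  proof (rule set_eqI)
    fix i show "i \<in> ?B \<longleftrightarrow> i \<in> ?C" by (cases i) auto
  qed
  moreover have "finite ?A" by simp
  then have "card ?C = (if a < b then 1 else 0) + card ?A"
    by (simp add: card_insert_if card_image)
  ultimately show ?thesis by (simp only: asc_def)
qed

text \<open>Repeating \<open>last x\<close> in front of \<open>u\<close> accounts for a possible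
  ascent at the seam.\<close>

lemma asc_append: "x \<noteq> [] \<Longrightarrow> asc (x @ u) = asc x + asc (last x # u)"
  by (induction x rule: induct_list012) (auto simp: asc_singleton asc_Cons_Cons)

lemma asc_Cons_le: "asc (a # u) \<le> asc (b # u) + 1"
  by (cases u) (auto simp: asc_singleton asc_Cons_Cons)

lemma asc_Cons_zero: "asc (a # u) \<le> asc (0 # u)"
  by (cases u) (auto simp: asc_singleton asc_Cons_Cons)

lemma asc_staircase: "asc [0..<Suc k] = k"
proof (induction k)
  case (Suc k)
  have "asc ([0..<Suc k] @ [Suc k]) = asc [0..<Suc k] + asc (last [0..<Suc k] # [Suc k])"
    by (rule asc_append) simp
  then show ?case using Suc by (simp add: asc_Cons_Cons asc_singleton)
qed (simp add: asc_singleton)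

text \<open>The last entry adds at most one ascent, so by induction the shorter prefix is the
  staircase. The last step must then be an ascent from \<open>k\<close>, and the growth bound leaves
  only \<open>Suc k\<close>.\<close>

lemma asc_staircase_unique:
  "x \<in> growth_sequences asc (Suc k) \<Longrightarrow> k \<le> asc x \<Longrightarrow> x = [0..<Suc k]"
proof (induction k arbitrary: x)
  case 0
  then show ?case by (cases x) (auto simp: growth_sequences_def)
next
  case (Suc k)
  let ?y = "take (Suc k) x"
  have len: "length x = Suc (Suc k)" using Suc.prems by (simp add: growth_sequences_def)
  have x: "x = ?y @ [x ! Suc k]"
    using len by (metis lessI take_Suc_conv_app_nth take_all order_refl)
  have ne: "?y \<noteq> []" using len by auto
  have asc: "asc x = asc ?y + asc [last ?y, x ! Suc k]"
    using asc_append[OF ne, of "[x ! Suc k]"] x by metis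
  then have "k \<le> asc ?y"
    using Suc.prems(2) by (simp add: asc_Cons_Cons asc_singleton split: if_splits)
  with take_growth_sequences[OF Suc.prems(1)] have y: "?y = [0..<Suc k]"
    by (intro Suc.IH) simp_all
  then have "asc ?y = k" "last ?y = k" using asc_staircase[of k] by simp_all
  then have "k < x ! Suc k"
    using asc Suc.prems(2) by (simp add: asc_Cons_Cons asc_singleton split: if_splits)
  moreover have "x ! Suc k \<le> asc ?y + 1" using Suc.prems(1) by (simp add: growth_sequences_def)
  then have "x ! Suc k \<le> Suc k" using \<open>asc ?y = k\<close> by simp
  ultimately have "x ! Suc k = Suc k" by simp
  then show ?case using x y by simp
qed

interpretation asc: growth_statistic asc
proof
  show "asc [0..<Suc k] = k" for k by (rule asc_staircase)
  show "x = [0..<Suc k]" if "x \<in> growth_sequences asc (Suc k)" "k \<le> asc x" for x k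
    using asc_staircase_unique that by blast
  show "asc (x @ u) \<le> asc ([0..<Suc k] @ u)" if x: "x \<in> growth_sequences asc (Suc k)" for x k u
  proof (cases "k \<le> asc x")
    case True
    then show ?thesis using asc_staircase_unique[OF x] by simp
  next
    case False
    have "x \<noteq> []" using x by (auto simp: growth_sequences_def)
    then have "asc (x @ u) = asc x + asc (last x # u)" by (rule asc_append)
    \<comment> \<open>Putting \<open>k\<close> in place of \<open>last x\<close> can lose one ascent
      at the seam; the strict inequality \<open>asc x < k\<close> makes up for it.\<close>
    also have "\<dots> \<le> k + asc (k # u)" using False asc_Cons_le[of "last x" u k] by simp
    also have "\<dots> = asc ([0..<Suc k] @ u)"
      using asc_append[of "[0..<Suc k]" u] asc_staircase[of k] by simp
    finally show ?thesis .
  qed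
  show "asc (x @ u) \<le> asc ([0..<k] @ 0 # u)"
    if x: "x \<in> growth_sequences asc (Suc k)" and less: "x ! k < k" for x k u
  proof -
    have "x \<noteq> [0..<Suc k]" using less nth_staircase_prefix[of k x k] by auto
    then have "asc x < k" using asc_staircase_unique[OF x] by fastforce
    obtain j where j: "k = Suc j" using less by (cases k) auto
    have "x \<noteq> []" using x by (auto simp: growth_sequences_def)
    then have "asc (x @ u) = asc x + asc (last x # u)" by (rule asc_append)
    \<comment> \<open>A prefix other than the staircase has at most \<open>j\<close> ascents, and 0
      is the best entry in front of \<open>u\<close>.\<close>
    also have "\<dots> \<le> j + asc (0 # u)" using \<open>asc x < k\<close> j asc_Cons_zero[of "last x" u] by simp
    also have "\<dots> = asc ([0..<k] @ 0 # u)"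
      using asc_append[of "[0..<k]" "0 # u"] asc_staircase[of j] j by (simp add: asc_Cons_Cons)
    finally show ?thesis .
  qed
qed

section \<open>The maximum as a growth statistic\<close>

abbreviation max_entry :: "nat list \<Rightarrow> nat" where
  "max_entry s \<equiv> Max (set s)"

lemma max_entry_append_mono:
  "x \<noteq> [] \<Longrightarrow> y \<noteq> [] \<Longrightarrow> max_entry x \<le> max_entry y \<Longrightarrow> max_entry (x @ u) \<le> max_entry (y @ u)"
  by (cases "u = []") (auto simp: Max_Un)

lemma max_entry_staircase: "max_entry [0..<Suc k] = k"
  by (rule Max_eqI) auto

text \<open>The upper bound is carried through the induction because it keeps the shorter prefix
  below \<open>Suc k\<close>: a maximum \<open>Suc k\<close> must come from the last entry, and the
  growth bound then forces the shorter prefix to reach \<open>k\<close>.\<close>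

lemma max_entry_staircase_unique:
  "x \<in> growth_sequences max_entry (Suc k) \<Longrightarrow> max_entry x \<le> k \<and> (k \<le> max_entry x \<longrightarrow> x = [0..<Suc k])"
proof (induction k arbitrary: x)
  case 0
  then show ?case by (cases x) (auto simp: growth_sequences_def)
next
  case (Suc k)
  let ?y = "take (Suc k) x"
  have len: "length x = Suc (Suc k)" using Suc.prems by (simp add: growth_sequences_def)
  have x: "x = ?y @ [x ! Suc k]"
    using len by (metis lessI take_Suc_conv_app_nth take_all order_refl)
  have ne: "?y \<noteq> []" using len by auto
  have "set x = insert (x ! Suc k) (set ?y)"
    using arg_cong[OF x, of set] by simp
  then have max: "max_entry x = max (x ! Suc k) (max_entry ?y)"
    using ne by simp
  have IH: "max_entry ?y \<le> k" "k \<le> max_entry ?y \<Longrightarrow> ?y = [0..<Suc k]"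
    using Suc.IH[of ?y] take_growth_sequences[OF Suc.prems] by auto
  have bound: "x ! Suc k \<le> max_entry ?y + 1" using Suc.prems by (simp add: growth_sequences_def)
  have "x = [0..<Suc (Suc k)]" if "Suc k \<le> max_entry x"
  proof -
    have "x ! Suc k = Suc k" "k \<le> max_entry ?y" using that max bound IH(1) by auto
    then show ?thesis using IH(2) x by simp
  qed
  then show ?case using max bound IH(1) by auto
qed

text \<open>A common continuation preserves comparisons of maxima, so both domination conditions
  reduce to prefixes. One that is not the staircase has maximum at most \<open>k - 1\<close>, which
  the staircase with final 0 attains.\<close>

interpretation max: growth_statistic max_entry
proof
  show "max_entry [0..<Suc k] = k" for k by (rule max_entry_staircase)
  show "x = [0..<Suc k]" if "x \<in> growth_sequences max_entry (Suc k)" "k \<le> max_entry x" for x k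
    using max_entry_staircase_unique that by blast
  have ne: "x \<noteq> []" if "x \<in> growth_sequences max_entry (Suc k)" for x k
    using that by (auto simp: growth_sequences_def)
  show "max_entry (x @ u) \<le> max_entry ([0..<Suc k] @ u)"
    if "x \<in> growth_sequences max_entry (Suc k)" for x k u
    using max_entry_append_mono[OF ne[OF that], of "[0..<Suc k]" u]
      max_entry_staircase_unique[OF that] max_entry_staircase[of k] by simp
  show "max_entry (x @ u) \<le> max_entry ([0..<k] @ 0 # u)"
    if x: "x \<in> growth_sequences max_entry (Suc k)" and less: "x ! k < k" for x k u
  proof -
    have "x \<noteq> [0..<Suc k]" using less nth_staircase_prefix[of k x k] by auto
    then have "max_entry x < k" using max_entry_staircase_unique[OF x] by fastforce
    moreover obtain j where j: "k = Suc j" using less by (cases k) auto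
    have "max_entry ([0..<k] @ [0]) = j" by (rule Max_eqI) (auto simp: j)
    ultimately show ?thesis
      using max_entry_append_mono[OF ne[OF x], of "[0..<k] @ [0]" u] j by simp
  qed
qed

theorem theorem3:
  fixes n :: nat
  assumes "n \<ge> 1"
  shows "\<forall>S \<in> {ascent_sequences n, restricted_growth_functions n}.
    (\<exists>!L. lists_in_order (\<prec>\<^sub>c) S L) \<and>
    (\<forall>L. lists_in_order (\<prec>\<^sub>c) S L \<longrightarrow> adjacent_gray_code 2 L)"
proof -
  have "ascent_sequences n = growth_sequences asc n"
    "restricted_growth_functions n = growth_sequences max_entry n"
    by (simp_all add: ascent_sequences_def restricted_growth_functions_def growth_sequences_def)
  then show ?thesis
    using asc.growth_sequences_gray_code max.growth_sequences_gray_code by simp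
qed

end
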